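(* Let $F(\bm{\lambda})=\sum_{i\in[I]}a_i\prod_{j\in[p]}\lambda_j^{n_{i,j}}$ on $\mathbb{R}^p$ with $a_i\in\mathbb{R}$ and nonnegative integers $n_{i,j}$, let $K>\max\{F(\bm{\lambda}):\bm{1}^\top\bm{\lambda}=1,\ \bm{\lambda}\ge\bm{0}\}$, and for $\bm{\theta}=(\theta_1,\ldots,\theta_{p-1})^\top$ let $f(\bm{\theta})=-\ln\big(K-F(\theta_1,\ldots,\theta_{p-1},1-\bm{1}^\top\bm{\theta})\big)$. Let $m\in\mathbb{N}$ satisfy $m\ge\max\{\sum_{j\in[p]}n_{i,j}:i\in[I]\}$. If $G$ is defined by $G(\bm{x})=K-\sum_{i\in[I]}a_ig_i(\bm{x})$, where $$g_i(\bm{x}):=\begin{cases}\dfrac{\prod_{j\in[p]}x_j(x_j-1)\cdots(x_j-n_{i,j}+1)}{m(m-1)\cdots\big(m-\sum_{j\in[p]}n_{i,j}+1\big)},&\sum_{j\in[p]}n_{i,j}>0,\\ 1,&\sum_{j\in[p]}n_{i,j}=0,\end{cases}$$ with $\bm{x}=(x_1,\ldots,x_{p-1})^\top$ and $x_p=m-\bm{1}^\top\bm{x}$, then $$f(\bm{\theta})=-\ln\mathbb{E}_{p_{\bm{x}}(\bm{\theta})}[G(\bm{X})]\qquad\text{for all }\bm{\theta}\in\mathrm{int}\,\Theta,\quad\Theta=\{\bm{\theta}\in\mathbb{R}^{p-1}:\bm{\theta}\ge\bm{0},\ \bm{1}^\top\bm{\theta}\le1\},$$ where $\bm{X}$ follows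 the multinomial distribution $p_{\bm{x}}(\bm{\theta})$ with parameters $m$ and $\bm{\theta}$.
   Context: $[n]:=\{1,\ldots,n\}$; $\bm{1}$ is the all-ones vector of appropriate dimension. The multinomial distribution here is on $\bm{x}\in\Xi=\{\bm{x}\in(\{0\}\cup\mathbb{N})^{p-1}:\bm{1}^\top\bm{x}\le m\}$ with probability mass $p_{\bm{x}}(\bm{\theta})=\frac{m!}{x_1!\cdots x_{p-1}!(m-\bm{1}^\top\bm{x})!}\prod_{j\in[p-1]}\theta_j^{x_j}(1-\bm{1}^\top\bm{\theta})^{m-\bm{1}^\top\bm{x}}$, and $\mathbb{E}_{p_{\bm{x}}(\bm{\theta})}$ is the corresponding expectation. A falling factorial $x_j(x_j-1)\cdots(x_j-n_{i,j}+1)$ with $n_{i,j}=0$ is the empty product, equal to $1$. *)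

theory Defs
  imports "HOL-Probability.Probability"
begin

text \<open>
  Vectors of length \<open>d\<close> are functions on \<open>nat\<close> that are extensional on \<open>{1..d}\<close>, so that
  \<open>p\<close> stays a number and length \<open>p - 1\<close> and length \<open>p\<close> can occur side by side.
  A vector of length \<open>p - 1\<close> is completed to one of length \<open>p\<close> by updating at \<open>p\<close>.
  The Euclidean topology on vectors of length \<open>d\<close> is \<open>powertop_real {1..d}\<close>.
\<close>

definition poly_F :: "nat \<Rightarrow> nat \<Rightarrow> (nat \<Rightarrow> real) \<Rightarrow> (nat \<Rightarrow> nat \<Rightarrow> nat) \<Rightarrow> (nat \<Rightarrow> real) \<Rightarrow> real" where
  "poly_F p I a n l = (\<Sum>i\<in>{1..I}. a i * (\<Prod>j\<in>{1..p}. l j ^ n i j))"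

definition prob_simplex :: "nat \<Rightarrow> (nat \<Rightarrow> real) set" where
  "prob_simplex p =
     {l \<in> {1..p} \<rightarrow>\<^sub>E UNIV. (\<Sum>j\<in>{1..p}. l j) = 1 \<and> (\<forall>j\<in>{1..p}. 0 \<le> l j)}"

definition Theta :: "nat \<Rightarrow> (nat \<Rightarrow> real) set" where
  "Theta p =
     {\<theta> \<in> {1..p - 1} \<rightarrow>\<^sub>E UNIV. (\<forall>j\<in>{1..p - 1}. 0 \<le> \<theta> j) \<and> (\<Sum>j\<in>{1..p - 1}. \<theta> j) \<le> 1}"

definition f_fun ::
  "nat \<Rightarrow> nat \<Rightarrow> (nat \<Rightarrow> real) \<Rightarrow> (nat \<Rightarrow> nat \<Rightarrow> nat) \<Rightarrow> real \<Rightarrow> (nat \<Rightarrow> real) \<Rightarrow> real" where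
  "f_fun p I a n K \<theta> =
     - ln (K - poly_F p I a n (\<theta>(p := 1 - (\<Sum>j\<in>{1..p - 1}. \<theta> j))))"

definition Xi :: "nat \<Rightarrow> nat \<Rightarrow> (nat \<Rightarrow> nat) set" where
  "Xi p m = {x \<in> {1..p - 1} \<rightarrow>\<^sub>E UNIV. (\<Sum>j\<in>{1..p - 1}. x j) \<le> m}"

definition multinomial_mass :: "nat \<Rightarrow> nat \<Rightarrow> (nat \<Rightarrow> real) \<Rightarrow> (nat \<Rightarrow> nat) \<Rightarrow> real" where
  "multinomial_mass p m \<theta> x =
     fact m / ((\<Prod>j\<in>{1..p - 1}. fact (x j)) * fact (m - (\<Sum>j\<in>{1..p - 1}. x j)))
     * (\<Prod>j\<in>{1..p - 1}. \<theta> j ^ x j)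
     * (1 - (\<Sum>j\<in>{1..p - 1}. \<theta> j)) ^ (m - (\<Sum>j\<in>{1..p - 1}. x j))"

text \<open>For \<open>\<theta> \<in> Theta p\<close> this is well defined, see \<open>pmf_multinomial_pmf\<close> below.\<close>

definition multinomial_pmf :: "nat \<Rightarrow> nat \<Rightarrow> (nat \<Rightarrow> real) \<Rightarrow> (nat \<Rightarrow> nat) pmf" where
  "multinomial_pmf p m \<theta> = embed_pmf (\<lambda>x. if x \<in> Xi p m then multinomial_mass p m \<theta> x else 0)"

definition falling_factorial :: "nat \<Rightarrow> nat \<Rightarrow> real" where
  "falling_factorial x k = (\<Prod>i<k. real x - real i)"

text \<open>
  In \<open>g_fun\<close> the argument \<open>x\<close> has length \<open>p\<close>. In \<open>G_fun\<close> it has length \<open>p - 1\<close>, and the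
  truncating subtraction is exact for \<open>x \<in> Xi p m\<close>.
\<close>

definition g_fun :: "nat \<Rightarrow> (nat \<Rightarrow> nat \<Rightarrow> nat) \<Rightarrow> nat \<Rightarrow> nat \<Rightarrow> (nat \<Rightarrow> nat) \<Rightarrow> real" where
  "g_fun p n m i x =
     (if (\<Sum>j\<in>{1..p}. n i j) > 0
      then (\<Prod>j\<in>{1..p}. falling_factorial (x j) (n i j))
             / falling_factorial m (\<Sum>j\<in>{1..p}. n i j)
      else 1)"

definition G_fun ::
  "nat \<Rightarrow> nat \<Rightarrow> (nat \<Rightarrow> real) \<Rightarrow> (nat \<Rightarrow> nat \<Rightarrow> nat) \<Rightarrow> real \<Rightarrow> nat \<Rightarrow> (nat \<Rightarrow> nat) \<Rightarrow> real" where
  "G_fun p I a n K m x =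
     K - (\<Sum>i\<in>{1..I}. a i * g_fun p n m i (x(p := m - (\<Sum>j\<in>{1..p - 1}. x j))))"

lemma finite_bounded_ext:
  assumes "finite A"
  shows "finite {x \<in> A \<rightarrow>\<^sub>E (UNIV :: nat set). sum x A \<le> m}"
proof (rule finite_subset)
  show "{x \<in> A \<rightarrow>\<^sub>E (UNIV :: nat set). sum x A \<le> m} \<subseteq> A \<rightarrow>\<^sub>E {..m}"
  proof
    fix x assume x: "x \<in> {x \<in> A \<rightarrow>\<^sub>E (UNIV :: nat set). sum x A \<le> m}"
    have "x j \<le> m" if "j \<in> A" for j
      using member_le_sum[OF that, of x] assms x by fastforce
    with x show "x \<in> A \<rightarrow>\<^sub>E {..m}" by (auto simp: PiE_iff)
  qed
  show "finite (A \<rightarrow>\<^sub>E {..m})" using assms by (intro finite_PiE) auto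
qed

lemma multinomial_theorem:
  fixes t :: "'i \<Rightarrow> real"
  assumes "finite A"
  shows "(\<Sum>x\<in>{x \<in> A \<rightarrow>\<^sub>E (UNIV :: nat set). sum x A \<le> m}.
           fact m / ((\<Prod>j\<in>A. fact (x j)) * fact (m - sum x A)) * (\<Prod>j\<in>A. t j ^ x j) * s ^ (m - sum x A))
         = (sum t A + s) ^ m"
  using assms
proof (induction A arbitrary: m rule: finite_induct)
  case empty
  have "{x \<in> {} \<rightarrow>\<^sub>E (UNIV :: nat set). sum x ({}::'i set) \<le> m} = {\<lambda>_. undefined}" by auto
  then show ?case by simp
next
  case (insert b A)
  let ?S = "\<lambda>A m. {x \<in> A \<rightarrow>\<^sub>E (UNIV :: nat set). sum x A \<le> m}"
  let ?T = "\<lambda>A m x. fact m / ((\<Prod>j\<in>A. fact (x j)) * fact (m - sum x A)) * (\<Prod>j\<in>A. t j ^ x j) * s ^ (m - sum x A)"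
  let ?h = "\<lambda>(k::nat, y). y(b := k)"
  have upd: "sum (y(b := k)) A = sum y A" "(\<Prod>j\<in>A. fact ((y(b := k)) j)) = (\<Prod>j\<in>A. fact (y j) :: real)"
    "(\<Prod>j\<in>A. t j ^ (y(b := k)) j) = (\<Prod>j\<in>A. t j ^ y j)" for y :: "'i \<Rightarrow> nat" and k
    using insert.hyps by (auto intro!: sum.cong prod.cong)
  have "(\<Sum>x\<in>?S (insert b A) m. ?T (insert b A) m x)
      = (\<Sum>z\<in>(SIGMA k:{..m}. ?S A (m - k)). ?T (insert b A) m (?h z))"
  proof (rule sum.reindex_bij_witness[where i = "?h" and j = "\<lambda>x. (x b, x(b := undefined))"])
    fix x assume x: "x \<in> ?S (insert b A) m"
    have "sum (x(b := undefined)) A = sum x A" by (rule upd)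
    with x insert.hyps show "(x b, x(b := undefined)) \<in> (SIGMA k:{..m}. ?S A (m - k))"
      by (auto simp: PiE_iff extensional_def)
  next
    fix z assume z: "z \<in> (SIGMA k:{..m}. ?S A (m - k))"
    then show "?h z \<in> ?S (insert b A) m"
      using insert.hyps by (auto simp: PiE_iff extensional_def upd(1) simp del: fun_upd_apply)
        (auto split: if_splits)
    from z show "((?h z) b, (?h z)(b := undefined)) = z"
      using insert.hyps by (auto simp: PiE_iff extensional_def fun_eq_iff)
  qed auto
  also have "\<dots> = (\<Sum>k\<le>m. \<Sum>y\<in>?S A (m - k). ?T (insert b A) m (?h (k, y)))"
    by (subst sum.Sigma) (auto intro: finite_bounded_ext[OF insert.hyps(1)] simp: case_prod_unfold)
  also have "\<dots> = (\<Sum>k\<le>m. \<Sum>y\<in>?S A (m - k). real (m choose k) * t b ^ k * ?T A (m - k) y)"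
  proof (intro sum.cong refl)
    fix k y assume k: "k \<in> {..m}"
    have "real (m choose k) = fact m / (fact k * fact (m - k))"
      using k binomial_fact[of k m, where 'a = real] by simp
    then show "?T (insert b A) m (?h (k, y)) = real (m choose k) * t b ^ k * ?T A (m - k) y"
      using insert.hyps by (simp add: upd[unfolded fun_upd_apply])
  qed
  also have "\<dots> = (\<Sum>k\<le>m. real (m choose k) * t b ^ k * (sum t A + s) ^ (m - k))"
    by (simp only: insert.IH sum_distrib_left[symmetric])
  also have "\<dots> = (sum t (insert b A) + s) ^ m"
    by (simp only: sum.insert[OF insert.hyps] add.assoc binomial_ring[of "t b"])
  finally show ?case .
qed

lemma pmf_multinomial_pmf:
  assumes "\<theta> \<in> Theta p"
  shows "pmf (multinomial_pmf p m \<theta>) x = (if x \<in> Xi p m then multinomial_mass p m \<theta> x else 0)"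
  unfolding multinomial_pmf_def
proof (rule pmf_embed_pmf)
  let ?f = "\<lambda>x. if x \<in> Xi p m then multinomial_mass p m \<theta> x else 0"
  show nn: "0 \<le> ?f x" for x
    using assms by (auto simp: multinomial_mass_def Theta_def intro!: mult_nonneg_nonneg prod_nonneg divide_nonneg_nonneg)
  have fin: "finite (Xi p m)" unfolding Xi_def by (rule finite_bounded_ext) simp
  have "(\<integral>\<^sup>+ x. ennreal (?f x) \<partial>count_space UNIV) = (\<Sum>x\<in>Xi p m. ennreal (?f x))"
    by (rule nn_integral_count_space'[OF fin]) auto
  also have "\<dots> = ennreal (\<Sum>x\<in>Xi p m. ?f x)" by (intro sum_ennreal nn)
  also have "(\<Sum>x\<in>Xi p m. ?f x) = (\<Sum>x\<in>Xi p m. multinomial_mass p m \<theta> x)" by simp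
  also have "\<dots> = 1"
    using multinomial_theorem[of "{1..p - 1}" m \<theta> "1 - (\<Sum>j\<in>{1..p - 1}. \<theta> j)"]
    by (simp add: multinomial_mass_def Xi_def)
  finally show "(\<integral>\<^sup>+ x. ennreal (?f x) \<partial>count_space UNIV) = 1" by simp
qed

end

theory Submission
  imports Defs
begin

text \<open>
  Both sides are minus the logarithm of the same number: the factorial moment of the multinomial
  distribution of order \<open>r\<close> is the falling factorial of \<open>m\<close> of length \<open>\<Sum>j. r j\<close> times
  \<open>\<Prod>j. \<theta> j ^ r j\<close>, so \<open>G\<close> is an unbiased estimator of \<open>K - F\<close>. The factorial moment is
  computed by cancelling the falling factorials against the factorials in the mass function and
  shifting \<open>x\<close> by \<open>r\<close>, which leaves the multinomial expansion of exponent \<open>m - (\<Sum>j. r j)\<close>.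
\<close>

text \<open>The binomial form makes both facts needed below immediate: the value is 0 for
  \<open>x < k\<close> and nonzero for \<open>k \<le> x\<close>.\<close>

lemma falling_factorial_eq: "falling_factorial x k = fact k * real (x choose k)"
  by (simp add: falling_factorial_def binomial_gbinomial gbinomial_prod_rev lessThan_atLeast0)

lemma falling_factorial_eq_0: "x < k \<Longrightarrow> falling_factorial x k = 0"
  by (simp add: falling_factorial_eq)

lemma falling_factorial_add: "falling_factorial (x + k) k = fact (x + k) / fact x"
  by (simp add: falling_factorial_eq binomial_fact)

text \<open>The last category, whose count \<open>m - sum x A\<close> is fixed by the others, has
  weight \<open>s\<close> and order \<open>q\<close>. With \<open>t\<close> and \<open>s\<close>
  free of any normalisation this is a polynomial identity, and the shifted sum is an instance of
  \<open>multinomial_theorem\<close>.\<close>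

lemma multinomial_factorial_moment:
  fixes t :: "'i \<Rightarrow> real" and r :: "'i \<Rightarrow> nat"
  assumes fin: "finite A" and le: "sum r A + q \<le> m"
  shows "(\<Sum>x\<in>{x \<in> A \<rightarrow>\<^sub>E UNIV. sum x A \<le> m}.
           fact m / ((\<Prod>j\<in>A. fact (x j)) * fact (m - sum x A)) * (\<Prod>j\<in>A. t j ^ x j) * s ^ (m - sum x A)
           * ((\<Prod>j\<in>A. falling_factorial (x j) (r j)) * falling_factorial (m - sum x A) q))
         = falling_factorial m (sum r A + q) * ((\<Prod>j\<in>A. t j ^ r j) * s ^ q)
           * (sum t A + s) ^ (m - (sum r A + q))"
proof -
  let ?S = "\<lambda>m. {x \<in> A \<rightarrow>\<^sub>E (UNIV :: nat set). sum x A \<le> m}"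
  let ?T = "\<lambda>m x. fact m / ((\<Prod>j\<in>A. fact (x j)) * fact (m - sum x A)) * (\<Prod>j\<in>A. t j ^ x j) * s ^ (m - sum x A)"
  let ?ff = "\<lambda>x. (\<Prod>j\<in>A. falling_factorial (x j) (r j)) * falling_factorial (m - sum x A) q"
  let ?shift = "\<lambda>y. restrict (\<lambda>j. y j + r j) A"
  define N where "N = sum r A + q"
  have N: "N \<le> m" using le by (simp add: N_def)
  \<comment> \<open>Outside \<open>S'\<close> some count is below its order, so its falling
    factorial contains the factor 0.\<close>
  define S' where "S' = {x \<in> ?S m. (\<forall>j\<in>A. r j \<le> x j) \<and> q \<le> m - sum x A}"
  have "(\<Sum>x\<in>?S m. ?T m x * ?ff x) = (\<Sum>x\<in>S'. ?T m x * ?ff x)"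
  proof (rule sum.mono_neutral_right)
    show "finite (?S m)" by (rule finite_bounded_ext[OF fin])
    show "\<forall>x\<in>?S m - S'. ?T m x * ?ff x = 0"
    proof
      fix x assume "x \<in> ?S m - S'"
      then have "(\<exists>j\<in>A. x j < r j) \<or> m - sum x A < q"
        by (auto simp: S'_def not_le)
      then have "?ff x = 0"
      proof
        assume "\<exists>j\<in>A. x j < r j"
        then have "(\<Prod>j\<in>A. falling_factorial (x j) (r j)) = 0"
          using fin falling_factorial_eq_0 by (intro prod_zero) blast+
        then show ?thesis by simp
      qed (simp add: falling_factorial_eq_0)
      then show "?T m x * ?ff x = 0" by simp
    qed
  qed (auto simp: S'_def)
  \<comment> \<open>The shift by \<open>q\<close> in the last category is implicit in lowering the
    bound from \<open>m\<close> to \<open>m - N\<close>. Restricting to \<open>A\<close> keeps the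
    vectors extensional, so that the two maps are mutually inverse.\<close>
  also have "\<dots> = (\<Sum>y\<in>?S (m - N). ?T m (?shift y) * ?ff (?shift y))"
  proof (rule sum.reindex_bij_witness[where i = ?shift and j = "\<lambda>x. restrict (\<lambda>j. x j - r j) A"])
    fix x assume x: "x \<in> S'"
    then have ext: "x \<in> extensional A" and ge: "\<And>j. j \<in> A \<Longrightarrow> r j \<le> x j"
      by (auto simp: S'_def PiE_iff)
    show eq: "?shift (restrict (\<lambda>j. x j - r j) A) = x"
      using ext ge by (auto simp: fun_eq_iff extensional_def)
    \<comment> \<open>Truncated subtraction is exact on \<open>S'\<close>; with
      \<open>q \<le> m - sum x A\<close> this bounds the new sum by \<open>m - N\<close>.\<close>
    have "(\<Sum>j\<in>A. x j - r j) + sum r A = sum x A"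
      using ge by (simp flip: sum.distrib)
    then show "restrict (\<lambda>j. x j - r j) A \<in> ?S (m - N)"
      using x by (auto simp: S'_def N_def)
    show "?T m (?shift (restrict (\<lambda>j. x j - r j) A)) * ?ff (?shift (restrict (\<lambda>j. x j - r j) A))
        = ?T m x * ?ff x"
      by (simp only: eq)
  next
    fix y assume y: "y \<in> ?S (m - N)"
    then show "restrict (\<lambda>j. ?shift y j - r j) A = y"
      by (auto simp: fun_eq_iff PiE_iff extensional_def)
    show "?shift y \<in> S'"
      using y N by (auto simp: S'_def N_def sum.distrib)
  qed
  also have "\<dots> = (\<Sum>y\<in>?S (m - N).
      falling_factorial m N * ((\<Prod>j\<in>A. t j ^ r j) * s ^ q) * ?T (m - N) y)"
  proof (intro sum.cong refl)
    fix y assume y: "y \<in> ?S (m - N)"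
    \<comment> \<open>\<open>d\<close> is the last count belonging to \<open>y\<close>; its shifted
      value is \<open>d + q\<close>, the form that \<open>falling_factorial_add\<close>
      expects.\<close>
    define d where "d = m - N - sum y A"
    have d: "m - sum (?shift y) A = d + q"
    proof -
      have "sum (?shift y) A = sum y A + sum r A"
        by (simp add: sum.distrib)
      moreover have "sum y A \<le> m - N" using y by simp
      ultimately show ?thesis using N unfolding d_def N_def by linarith
    qed
    have ff: "?ff (?shift y)
        = (\<Prod>j\<in>A. fact (y j + r j)) / (\<Prod>j\<in>A. fact (y j)) * (fact (d + q) / fact d)"
      unfolding d by (simp add: falling_factorial_add prod_dividef)
    have ffm: "falling_factorial m N = fact m / fact (m - N)"
      using falling_factorial_add[of "m - N" N] N by simp
    have prods: "(\<Prod>j\<in>A. fact (?shift y j) :: real) = (\<Prod>j\<in>A. fact (y j + r j))"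
      "(\<Prod>j\<in>A. t j ^ ?shift y j) = (\<Prod>j\<in>A. t j ^ y j) * (\<Prod>j\<in>A. t j ^ r j)"
      by (simp_all add: power_add prod.distrib)
    \<comment> \<open>Here \<open>u\<close>, \<open>v\<close> are the factorials of the shifted
      counts, \<open>u'\<close>, \<open>v'\<close> those of the original ones, and \<open>w\<close>
      is \<open>fact (m - N)\<close>. Abstract variables keep the products and factorials opaque
      during the cancellation.\<close>
    have cancel: "c / (u * v) * (b * b') * (e * e') * (u / u' * (v / v'))
        = c / w * (b' * e') * (w / (u' * v') * b * e)"
      if "u \<noteq> 0" "v \<noteq> 0" "w \<noteq> 0" for b b' c e e' u u' v v' w :: real
      using that by simp
    have nz: "(\<Prod>j\<in>A. fact (y j + r j) :: real) \<noteq> 0"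
      using fin by simp
    show "?T m (?shift y) * ?ff (?shift y)
        = falling_factorial m N * ((\<Prod>j\<in>A. t j ^ r j) * s ^ q) * ?T (m - N) y"
      unfolding ff unfolding ffm d d_def[symmetric] prods power_add
      by (rule cancel[OF nz fact_nonzero fact_nonzero])
  qed
  also have "\<dots> = falling_factorial m N * ((\<Prod>j\<in>A. t j ^ r j) * s ^ q) * (sum t A + s) ^ (m - N)"
    by (simp only: multinomial_theorem[OF fin] flip: sum_distrib_left)
  finally show ?thesis unfolding N_def .
qed

lemma finite_Xi: "finite (Xi p m)"
  unfolding Xi_def by (rule finite_bounded_ext) simp

lemma expectation_multinomial_pmf:
  assumes "\<theta> \<in> Theta p"
  shows "measure_pmf.expectation (multinomial_pmf p m \<theta>) h
    = (\<Sum>x\<in>Xi p m. h x * multinomial_mass p m \<theta> x)"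
proof -
  have "measure_pmf.expectation (multinomial_pmf p m \<theta>) h
      = (\<Sum>x\<in>Xi p m. h x * pmf (multinomial_pmf p m \<theta>) x)"
    by (rule integral_measure_pmf_real[OF finite_Xi])
      (simp add: set_pmf_iff pmf_multinomial_pmf[OF assms] split: if_splits)
  then show ?thesis by (simp add: pmf_multinomial_pmf[OF assms])
qed

lemma sum_multinomial_mass: "(\<Sum>x\<in>Xi p m. multinomial_mass p m \<theta> x) = 1"
  using multinomial_theorem[of "{1..p - 1}" m \<theta> "1 - (\<Sum>j\<in>{1..p - 1}. \<theta> j)"]
  by (simp add: multinomial_mass_def Xi_def)

text \<open>If the exponents sum to 0, every falling factorial is an empty product and the quotient
  is 1 / 1, so one formula covers both cases.\<close>

lemma g_fun_eq:
  "g_fun p n m i x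
    = (\<Prod>j\<in>{1..p}. falling_factorial (x j) (n i j)) / falling_factorial m (\<Sum>j\<in>{1..p}. n i j)"
  by (auto simp: g_fun_def falling_factorial_eq)

text \<open>For \<open>s = 1 - (\<Sum>j\<in>{1..p - 1}. \<theta> j)\<close> the remaining power in
  the factorial moment has base 1, and the denominator of \<open>g_fun\<close> cancels the constant
  in front.\<close>

lemma sum_g_fun_multinomial_mass:
  assumes p: "p \<ge> 1" and le: "(\<Sum>j\<in>{1..p}. n i j) \<le> m"
  shows "(\<Sum>x\<in>Xi p m. g_fun p n m i (x(p := m - (\<Sum>j\<in>{1..p - 1}. x j))) * multinomial_mass p m \<theta> x)
    = (\<Prod>j\<in>{1..p}. (\<theta>(p := 1 - (\<Sum>j\<in>{1..p - 1}. \<theta> j))) j ^ n i j)"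
proof -
  let ?A = "{1..p - 1}"
  have A: "{1..p} = insert p ?A" "p \<notin> ?A" using p by auto
  have N: "(\<Sum>j\<in>{1..p}. n i j) = (\<Sum>j\<in>?A. n i j) + n i p"
    using A by simp
  have ff: "(\<Prod>j\<in>{1..p}. falling_factorial ((x(p := k)) j) (n i j))
      = (\<Prod>j\<in>?A. falling_factorial (x j) (n i j)) * falling_factorial k (n i p)" for x :: "nat \<Rightarrow> nat" and k
    unfolding A(1) using A(2) by (auto intro!: prod.cong)
  have pw: "(\<Prod>j\<in>{1..p}. (\<theta>(p := u)) j ^ n i j) = (\<Prod>j\<in>?A. \<theta> j ^ n i j) * u ^ n i p" for u
    unfolding A(1) using A(2) by (auto intro!: prod.cong)
  \<comment> \<open>The total degree is at most \<open>m\<close>, so no factor of the denominator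
    vanishes.\<close>
  have nz: "falling_factorial m (\<Sum>j\<in>{1..p}. n i j) \<noteq> 0"
    using le by (simp add: falling_factorial_eq)
  have "(\<Sum>x\<in>Xi p m. multinomial_mass p m \<theta> x
          * ((\<Prod>j\<in>?A. falling_factorial (x j) (n i j)) * falling_factorial (m - sum x ?A) (n i p)))
      = falling_factorial m (\<Sum>j\<in>{1..p}. n i j)
        * ((\<Prod>j\<in>?A. \<theta> j ^ n i j) * (1 - (\<Sum>j\<in>?A. \<theta> j)) ^ n i p)"
    using multinomial_factorial_moment[of ?A "n i" "n i p" m \<theta> "1 - (\<Sum>j\<in>?A. \<theta> j)"] le
    unfolding N multinomial_mass_def Xi_def by simp
  then show ?thesis
    unfolding g_fun_eq ff pw using nz
    by (simp add: mult.commute divide_simps flip: sum_divide_distrib)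
qed

text \<open>By linearity: the masses sum to 1, which leaves \<open>K\<close>, and each
  \<open>g_fun\<close> averages to its monomial.\<close>

lemma expectation_G_fun:
  assumes "p \<ge> 1" and \<theta>: "\<theta> \<in> Theta p"
    and le: "\<And>i. i \<in> {1..I} \<Longrightarrow> (\<Sum>j\<in>{1..p}. n i j) \<le> m"
  shows "measure_pmf.expectation (multinomial_pmf p m \<theta>) (G_fun p I a n K m)
    = K - poly_F p I a n (\<theta>(p := 1 - (\<Sum>j\<in>{1..p - 1}. \<theta> j)))"
proof -
  let ?g = "\<lambda>i x. g_fun p n m i (x(p := m - (\<Sum>j\<in>{1..p - 1}. x j)))"
  let ?M = "multinomial_mass p m \<theta>"
  have "(\<Sum>x\<in>Xi p m. G_fun p I a n K m x * ?M x)
      = K * (\<Sum>x\<in>Xi p m. ?M x) - (\<Sum>x\<in>Xi p m. \<Sum>i\<in>{1..I}. a i * (?g i x * ?M x))"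
    by (simp add: G_fun_def left_diff_distrib sum_subtractf sum_distrib_left sum_distrib_right mult.assoc)
  also have "\<dots> = K - (\<Sum>i\<in>{1..I}. a i * (\<Sum>x\<in>Xi p m. ?g i x * ?M x))"
    by (subst sum.swap) (simp add: sum_multinomial_mass sum_distrib_left)
  also have "\<dots> = K - poly_F p I a n (\<theta>(p := 1 - (\<Sum>j\<in>{1..p - 1}. \<theta> j)))"
    unfolding poly_F_def
    by (intro arg_cong2[of K K _ _ "(-)"] refl sum.cong)
      (simp only: sum_g_fun_multinomial_mass[OF \<open>p \<ge> 1\<close> le])
  finally show ?thesis by (simp add: expectation_multinomial_pmf[OF \<theta>])
qed

theorem proposition4p6:
  fixes p I m :: nat
    and a :: "nat \<Rightarrow> real"
    and n :: "nat \<Rightarrow> nat \<Rightarrow> nat"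
    and K :: real
  assumes "p \<ge> 1" and "I \<ge> 1" and "m \<ge> 1"
    and "K > (SUP l\<in>prob_simplex p. poly_F p I a n l)"
    and "m \<ge> Max ((\<lambda>i. \<Sum>j\<in>{1..p}. n i j) ` {1..I})"
  shows "\<forall>\<theta>\<in>powertop_real {1..p - 1} interior_of Theta p.
           f_fun p I a n K \<theta> =
           - ln (measure_pmf.expectation (multinomial_pmf p m \<theta>) (G_fun p I a n K m))"
proof
  fix \<theta> assume "\<theta> \<in> powertop_real {1..p - 1} interior_of Theta p"
  \<comment> \<open>Membership makes the masses nonnegative, so that \<open>multinomial_pmf\<close>
    really has them as its probabilities.\<close>
  then have \<theta>: "\<theta> \<in> Theta p" by (rule subsetD[OF interior_of_subset])
  have le: "(\<Sum>j\<in>{1..p}. n i j) \<le> m" if "i \<in> {1..I}" for i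
    by (rule order_trans[OF Max_ge assms(5)]) (use that in auto)
  show "f_fun p I a n K \<theta> =
      - ln (measure_pmf.expectation (multinomial_pmf p m \<theta>) (G_fun p I a n K m))"
    by (simp only: f_fun_def expectation_G_fun[OF \<open>p \<ge> 1\<close> \<theta> le])
qed

end
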